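(* Let $Z_k=\min\{c,R_k\}-g/n$, $k\in\{1,\dots,n\}$, be the independent and identically distributed random variables built from the local cap $c\ge0$, the return process $R_k$ and the guaranteed rate $g$ at maturity. Let $T$ be the maturity time, $K$ the notional and $r>0$ the risk-less interest rate. Then the price $C_0$ at time zero of a cliquet option with payoff $H_T=K+K\max\{g,\sum_{k=1}^n\min\{c,R_k\}\}$ can be represented as $$C_0=Ke^{-rT}\Big(1+g+\frac n2\,\mathbb E_{\mathbb Q}[Z_1]+\frac1\pi\int_{0^+}^\infty\frac{1-\mathrm{Re}(\phi_Z(x))}{x^2}\,dx\Big),$$ where $\mathrm{Re}$ denotes the real part and $$\phi_Z(x):=\prod_{k=1}^n\phi_{Z_k}(x)=\prod_{k=1}^n\mathbb E_{\mathbb Q}[e^{ixZ_k}]=(\phi_{Z_1}(x))^n=\big(\mathbb E_{\mathbb Q}[e^{ixZ_1}]\big)^n .$$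
   Context: Under the risk-neutral measure $\mathbb Q$ the stock price is $S_t=S_0e^{X_t}$, $t\in[0,T]$, with the Lévy process $X_t=\gamma t+\sigma W_t+\sum_{j=1}^{N_t}Y_j$, where $W$ is a standard Brownian motion, $N_t$ a Poisson process with intensity $\lambda>0$, $Y_1,Y_2,\dots$ i.i.d. real random variables (jump amplitudes), all independent under $\mathbb Q$; $\sigma>0$, $\gamma=\eta-\sigma^2/2$, and the Lévy measure $\nu$ of $X$ is $\lambda$ times the law of $Y_1$. Risk-neutrality means $\eta=r-\int_{\mathbb R}[e^z-1]\,d\nu(z)$. Resetting times: $0<t_0<t_1<\dots<t_n\le T$ equidistant with $\tau=t_k-t_{k-1}$, $n\in\mathbb N$. Returns: $R_k=(S_{t_k}-S_{t_{k-1}})/S_{t_{k-1}}=e^{X_{t_k}-X_{t_{k-1}}}-1$. The bank account is $B_t=e^{rt}$. The time-zero price of a payoff $H_T$ is $C_0=e^{-rT}\,\mathbb E_{\mathbb Q}[H_T]$. *)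

theory Defs
  imports "HOL-Probability.Probability"
begin

definition independent_increments ::
    "'a measure \<Rightarrow> 'b measure \<Rightarrow> real \<Rightarrow> (real \<Rightarrow> 'a \<Rightarrow> 'b :: minus) \<Rightarrow> bool" where
  "independent_increments Q M' T X \<longleftrightarrow>
     (\<forall>(m::nat) s. mono_on {..m} s \<and> 0 \<le> s 0 \<and> s m \<le> T \<longrightarrow>
        prob_space.indep_vars Q (\<lambda>_. M') (\<lambda>i \<omega>. X (s (Suc i)) \<omega> - X (s i) \<omega>) {..<m})"

definition standard_brownian_motion :: "'a measure \<Rightarrow> real \<Rightarrow> (real \<Rightarrow> 'a \<Rightarrow> real) \<Rightarrow> bool" where
  "standard_brownian_motion Q T W \<longleftrightarrow>
     (\<forall>t\<in>{0..T}. W t \<in> borel_measurable Q) \<and>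
     (AE \<omega> in Q. W 0 \<omega> = 0) \<and>
     (AE \<omega> in Q. continuous_on {0..T} (\<lambda>t. W t \<omega>)) \<and>
     independent_increments Q borel T W \<and>
     (\<forall>s t. 0 \<le> s \<and> s < t \<and> t \<le> T \<longrightarrow>
        distributed Q lborel (\<lambda>\<omega>. W t \<omega> - W s \<omega>) (normal_density 0 (sqrt (t - s))))"

(* The paths are almost surely nondecreasing, so the truncated subtraction on nat
   is the actual increment outside a null set. *)
definition poisson_process :: "'a measure \<Rightarrow> real \<Rightarrow> real \<Rightarrow> (real \<Rightarrow> 'a \<Rightarrow> nat) \<Rightarrow> bool" where
  "poisson_process Q lam T N \<longleftrightarrow>
     (\<forall>t\<in>{0..T}. N t \<in> measurable Q (count_space UNIV)) \<and>
     (AE \<omega> in Q. N 0 \<omega> = 0) \<and>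
     (AE \<omega> in Q. mono_on {0..T} (\<lambda>t. N t \<omega>)) \<and>
     (AE \<omega> in Q. \<forall>t\<in>{0..<T}. continuous (at_right t) (\<lambda>s. real (N s \<omega>))) \<and>
     independent_increments Q (count_space UNIV) T N \<and>
     (\<forall>s t. 0 \<le> s \<and> s < t \<and> t \<le> T \<longrightarrow>
        distr Q (count_space UNIV) (\<lambda>\<omega>. N t \<omega> - N s \<omega>) = measure_pmf (poisson_pmf (lam * (t - s))))"

definition generated_events ::
    "'a measure \<Rightarrow> 'b measure \<Rightarrow> 'i set \<Rightarrow> ('i \<Rightarrow> 'a \<Rightarrow> 'b) \<Rightarrow> 'a set set" where
  "generated_events Q M' I X = sigma_sets (space Q) {X i -` A \<inter> space Q |i A. i \<in> I \<and> A \<in> sets M'}"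

(* The processes W, N and the single jump amplitudes have different value types, so their
   mutual independence is expressed through the sigma-algebras they generate. *)
datatype noise = Diffusion | Counting | Jump nat

definition independent_noise ::
    "'a measure \<Rightarrow> real \<Rightarrow> (real \<Rightarrow> 'a \<Rightarrow> real) \<Rightarrow> (real \<Rightarrow> 'a \<Rightarrow> nat) \<Rightarrow> (nat \<Rightarrow> 'a \<Rightarrow> real) \<Rightarrow> bool" where
  "independent_noise Q T W N Y \<longleftrightarrow>
     prob_space.indep_sets Q
       (case_noise (generated_events Q borel {0..T} W)
                   (generated_events Q (count_space UNIV) {0..T} N)
                   (\<lambda>j. generated_events Q borel {j} Y))
       ({Diffusion, Counting} \<union> Jump ` {1..})"

definition jump_diffusion ::
    "real \<Rightarrow> real \<Rightarrow> (real \<Rightarrow> 'a \<Rightarrow> real) \<Rightarrow> (real \<Rightarrow> 'a \<Rightarrow> nat) \<Rightarrow> (nat \<Rightarrow> 'a \<Rightarrow> real) \<Rightarrow> real \<Rightarrow> 'a \<Rightarrow> real" where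
  "jump_diffusion \<gamma> \<sigma> W N Y t \<omega> = \<gamma> * t + \<sigma> * W t \<omega> + (\<Sum>j = 1..N t \<omega>. Y j \<omega>)"

definition time_zero_price :: "'a measure \<Rightarrow> real \<Rightarrow> real \<Rightarrow> ('a \<Rightarrow> real) \<Rightarrow> real" where
  "time_zero_price Q r T H = exp (- r * T) * (\<integral>\<omega>. H \<omega> \<partial>Q)"

end

(* Since max g (V + g) = g + (V + |V|) / 2 for V = Z 1 + ... + Z n, only E |V| has to be computed. It
   follows by Tonelli from |y| = (2 / pi) * integral of (1 - cos (x y)) / x^2 over x > 0, which reduces to
   the Dirichlet integral by parts.

   That the Z k are i.i.d. comes from the increments of the jump diffusion. The vector of Poisson counts
   is countably valued; given its value, the increments are sums over disjoint deterministic blocks of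
   independent variables, hence independent, and the law of such a sum depends only on the length of
   the block. Summing over the values, with independent and identically distributed counts, factorizes
   the joint law. *)
theory Submission
  imports Defs "HOL-Real_Asymp.Real_Asymp"
begin

section \<open>Absolute moments from characteristic functions\<close>

text \<open>Integration by parts produces the antiderivative \<open>Si x - (1 - cos x) / x\<close>.
  Its second term vanishes at both ends, so the value is the limit of \<open>Si\<close> at infinity.
  The \<open>nn_integral\<close> form is the one that Tonelli needs later.\<close>

lemma nn_integral_one_minus_cos_over_square:
  "(\<integral>\<^sup>+x. ennreal (indicator {0<..} x * ((1 - cos x) / x\<^sup>2)) \<partial>lborel) = ennreal (pi / 2)"
proof -
  define F where "F x = Si x - (1 - cos x) / x" for x
  let ?f = "\<lambda>x::real. (1 - cos x) / x\<^sup>2"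
  have F_deriv: "(F has_real_derivative ?f x) (at x)" if "x > 0" for x
  proof -
    have "((\<lambda>x. Si x - (1 - cos x) / x) has_real_derivative
        sinc x - (sin x * x - (1 - cos x)) / (x * x)) (at x)"
      using that by (auto intro!: derivative_eq_intros DERIV_Si)
    also have "sinc x - (sin x * x - (1 - cos x)) / (x * x) = ?f x"
      using that by (simp add: field_simps power2_eq_square)
    finally show ?thesis by (simp add: F_def[abs_def])
  qed
  have lim0: "(F \<longlongrightarrow> 0) (at_right 0)"
  proof -
    have "(Si \<longlongrightarrow> Si 0) (at_right 0)"
      using isCont_Si[of 0] by (simp add: isCont_def filterlim_at_split)
    moreover have "Si 0 = 0"
      by (simp add: Si_def zero_ereal_def[symmetric])
    moreover have "((\<lambda>x::real. (1 - cos x) / x) \<longlongrightarrow> 0) (at_right 0)"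
      by real_asymp
    ultimately have "((\<lambda>x. Si x - (1 - cos x) / x) \<longlongrightarrow> 0 - 0) (at_right 0)"
      by (intro tendsto_diff) auto
    then show ?thesis by (simp add: F_def[abs_def])
  qed
  have lim_top: "(F \<longlongrightarrow> pi / 2) at_top"
  proof -
    have "((\<lambda>x::real. (1 - cos x) / x) \<longlongrightarrow> 0) at_top"
      by real_asymp
    then have "((\<lambda>x. Si x - (1 - cos x) / x) \<longlongrightarrow> pi / 2 - 0) at_top"
      by (intro tendsto_diff Si_at_top)
    then show ?thesis by (simp add: F_def[abs_def])
  qed
  \<comment> \<open>Since the integrand is nonnegative, the two limits of \<open>F\<close> give
    integrability together with the value.\<close>
  have FTC: "set_integrable lborel (einterval 0 \<infinity>) ?f" "(LBINT x=0..\<infinity>. ?f x) = pi / 2 - 0"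
    using interval_integral_FTC_nonneg[of 0 \<infinity> F ?f 0 "pi / 2"] F_deriv lim0 lim_top
    by (auto simp: zero_ereal_def ereal_tendsto_simps)
  have "einterval 0 \<infinity> = {0<..}"
    by (auto simp: einterval_def zero_ereal_def)
  with FTC have "has_bochner_integral lborel (\<lambda>x. indicator {0<..} x * ?f x) (pi / 2)"
    unfolding interval_lebesgue_integral_0_infty
    by (simp add: has_bochner_integral_iff set_integrable_def set_lebesgue_integral_def)
  then show ?thesis
    by (subst nn_integral_eq_integral)
       (auto simp: has_bochner_integral_iff split: split_indicator)
qed

text \<open>As \<open>cos\<close> is even, \<open>y\<close> may be replaced by
  \<open>a = \<bar>y\<bar>\<close>; for \<open>a > 0\<close> the substitution of
  \<open>a * x\<close> for \<open>x\<close> reduces to the previous integral.\<close>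

lemma nn_integral_one_minus_cos_scaled:
  "(\<integral>\<^sup>+x. ennreal (indicator {0<..} x * ((1 - cos (x * y)) / x\<^sup>2)) \<partial>lborel) = ennreal (pi / 2 * \<bar>y\<bar>)"
proof (cases "y = 0")
  case False
  define a where "a = \<bar>y\<bar>"
  have a: "a > 0" using False by (simp add: a_def)
  have "cos (x * y) = cos (x * a)" for x
    by (simp add: a_def abs_if)
  \<comment> \<open>Rewriting the denominator in terms of \<open>a * x\<close> costs a factor
    \<open>a * a\<close>. One \<open>a\<close> is the Jacobian of the substitution, the other stays
    in the result. The summand \<open>0 +\<close> matches the affine form of the substitution
    rule.\<close>
  then have "(\<integral>\<^sup>+x. ennreal (indicator {0<..} x * ((1 - cos (x * y)) / x\<^sup>2)) \<partial>lborel)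
      = (\<integral>\<^sup>+x. ennreal (a * a) * ennreal (indicator {0<..} (0 + a * x) * ((1 - cos (0 + a * x)) / (0 + a * x)\<^sup>2)) \<partial>lborel)"
    using a by (intro nn_integral_cong)
      (auto simp: ennreal_mult[symmetric] field_simps power2_eq_square zero_less_mult_iff
         split: split_indicator)
  also have "\<dots> = ennreal a * (ennreal \<bar>a\<bar> * (\<integral>\<^sup>+x. ennreal (indicator {0<..} (0 + a * x) *
      ((1 - cos (0 + a * x)) / (0 + a * x)\<^sup>2)) \<partial>lborel))"
    using a by (subst nn_integral_cmult) (auto simp: ennreal_mult mult.assoc)
  also have "\<dots> = ennreal a * ennreal (pi / 2)"
    using a nn_integral_one_minus_cos_over_square by (subst nn_integral_real_affine[symmetric]) simp_all
  finally show ?thesis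
    using a by (simp add: ennreal_mult[symmetric] a_def mult.commute)
qed simp

text \<open>\<open>1 - Re (char ...)\<close> is the expectation of \<open>1 - cos (x * V)\<close>, a
  nonnegative quantity, so the integral over \<open>x\<close> may be moved inside the expectation.
  There it equals a multiple of \<open>\<bar>V\<bar>\<close>, and integrability of \<open>V\<close>
  makes the result finite, hence a genuine Bochner integral.\<close>

lemma (in prob_space) has_bochner_integral_one_minus_char:
  assumes V: "integrable M V"
  shows "has_bochner_integral lborel (\<lambda>x. indicator {0<..} x * ((1 - Re (char (distr M borel V) x)) / x\<^sup>2))
           (pi / 2 * expectation (\<lambda>\<omega>. \<bar>V \<omega>\<bar>))"
proof (rule has_bochner_integral_nn_integral)
  note [measurable] = borel_measurable_integrable[OF V]
  interpret D: real_distribution "distr M borel V" by simp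
  have char_eq: "Re (char (distr M borel V) x) = expectation (\<lambda>\<omega>. cos (x * V \<omega>))" for x
  proof -
    have "integrable M (\<lambda>\<omega>. iexp (x * V \<omega>))"
      by (intro integrable_const_bound[of _ 1]) auto
    then show ?thesis
      unfolding char_def by (simp add: integral_distr flip: integral_Re) (simp add: Re_exp)
  qed
  show "(\<lambda>x. indicator {0<..} x * ((1 - Re (char (distr M borel V) x)) / x\<^sup>2)) \<in> borel_measurable lborel"
    by measurable
  show "AE x in lborel. 0 \<le> indicator {0<..} x * ((1 - Re (char (distr M borel V) x)) / x\<^sup>2)"
  proof (intro AE_I2)
    fix x
    have "Re (char (distr M borel V) x) \<le> 1"
      using D.cmod_char_le_1[of x] complex_Re_le_cmod order_trans by blast
    then show "0 \<le> indicator {0<..} x * ((1 - Re (char (distr M borel V) x)) / x\<^sup>2)"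
      by (simp split: split_indicator)
  qed
  show "0 \<le> pi / 2 * expectation (\<lambda>\<omega>. \<bar>V \<omega>\<bar>)"
    by simp
  have inner: "ennreal (indicator {0<..} x * ((1 - Re (char (distr M borel V) x)) / x\<^sup>2)) =
      (\<integral>\<^sup>+\<omega>. ennreal (indicator {0<..} x * ((1 - cos (x * V \<omega>)) / x\<^sup>2)) \<partial>M)" for x
  proof -
    have int: "integrable M (\<lambda>\<omega>. cos (x * V \<omega>))"
      by (intro integrable_const_bound[of _ 1]) auto
    then have "(\<integral>\<^sup>+\<omega>. ennreal (indicator {0<..} x * ((1 - cos (x * V \<omega>)) / x\<^sup>2)) \<partial>M) =
        ennreal (expectation (\<lambda>\<omega>. indicator {0<..} x * ((1 - cos (x * V \<omega>)) / x\<^sup>2)))"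
      by (intro nn_integral_eq_integral) (auto split: split_indicator)
    also have "expectation (\<lambda>\<omega>. indicator {0<..} x * ((1 - cos (x * V \<omega>)) / x\<^sup>2)) =
        indicator {0<..} x * ((1 - expectation (\<lambda>\<omega>. cos (x * V \<omega>))) / x\<^sup>2)"
      using int by (simp add: prob_space)
    finally show ?thesis by (simp add: char_eq)
  qed
  interpret P: pair_sigma_finite lborel M ..
  have "(\<integral>\<^sup>+x. ennreal (indicator {0<..} x * ((1 - Re (char (distr M borel V) x)) / x\<^sup>2)) \<partial>lborel) =
      (\<integral>\<^sup>+\<omega>. \<integral>\<^sup>+x. ennreal (indicator {0<..} x * ((1 - cos (x * V \<omega>)) / x\<^sup>2)) \<partial>lborel \<partial>M)"
    unfolding inner by (rule P.Fubini'[symmetric]) measurable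
  also have "\<dots> = (\<integral>\<^sup>+\<omega>. ennreal (pi / 2 * \<bar>V \<omega>\<bar>) \<partial>M)"
    by (simp only: nn_integral_one_minus_cos_scaled)
  also have "\<dots> = ennreal (pi / 2 * expectation (\<lambda>\<omega>. \<bar>V \<omega>\<bar>))"
    using V by (subst nn_integral_eq_integral) auto
  finally show "(\<integral>\<^sup>+x. ennreal (indicator {0<..} x * ((1 - Re (char (distr M borel V) x)) / x\<^sup>2)) \<partial>lborel) =
      ennreal (pi / 2 * expectation (\<lambda>\<omega>. \<bar>V \<omega>\<bar>))" .
qed

section \<open>Independence\<close>

text \<open>Two-level independence: a finite intersection is grouped by first index, each group lies
  in the sigma-algebra \<open>F i\<close>, and the probability factorizes first across groups and
  then within each. This combines independent noise sources with independent increments inside a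
  source.\<close>

lemma (in prob_space) indep_sets_Sigma:
  assumes F: "indep_sets F I" "\<And>i. i \<in> I \<Longrightarrow> sigma_algebra (space M) (F i)"
    and G: "\<And>i. i \<in> I \<Longrightarrow> indep_sets (G i) (J i)" "\<And>i j. i \<in> I \<Longrightarrow> j \<in> J i \<Longrightarrow> G i j \<subseteq> F i"
  shows "indep_sets (\<lambda>(i, j). G i j) (Sigma I J)"
proof (rule indep_setsI)
  fix p assume "p \<in> Sigma I J"
  then show "(case p of (i, j) \<Rightarrow> G i j) \<subseteq> events"
    using F G by (fastforce simp: indep_sets_def)
next
  fix A K
  assume K: "K \<noteq> {}" "K \<subseteq> Sigma I J" "finite K"
    and A: "\<forall>p\<in>K. A p \<in> (case p of (i, j) \<Rightarrow> G i j)"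
  define L where "L i = {j. (i, j) \<in> K}" for i
  have K_eq: "K = Sigma (fst ` K) L"
    by (force simp: L_def)
  have L: "finite (L i)" "L i \<subseteq> J i" for i
  proof -
    have "L i = snd ` (K \<inter> {i} \<times> UNIV)" by (force simp: L_def)
    then show "finite (L i)" using K by simp
  qed (use K in \<open>auto simp: L_def\<close>)
  \<comment> \<open>Nonemptiness of the fibres matters twice: for membership of the inner
    intersection in \<open>F i\<close>, and for the product formula within the group.\<close>
  have L_ne: "L i \<noteq> {}" if "i \<in> fst ` K" for i
    using that by (force simp: L_def)
  have AG: "A (i, j) \<in> G i j" if "j \<in> L i" for i j
    using A that by (auto simp: L_def)
  have IK: "fst ` K \<subseteq> I" using K by auto
  have "(\<Inter>p\<in>K. A p) = (\<Inter>i\<in>fst ` K. \<Inter>j\<in>L i. A (i, j))"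
    by (subst K_eq) auto
  also have "prob \<dots> = (\<Prod>i\<in>fst ` K. prob (\<Inter>j\<in>L i. A (i, j)))"
  proof (rule indep_setsD[OF F(1) IK])
    show "\<forall>i\<in>fst ` K. (\<Inter>j\<in>L i. A (i, j)) \<in> F i"
    proof
      fix i assume i: "i \<in> fst ` K"
      then interpret sigma_algebra "space M" "F i"
        using F(2) IK by blast
      show "(\<Inter>j\<in>L i. A (i, j)) \<in> F i"
        using AG G(2)[of i] IK L[of i] L_ne[OF i] i by (intro finite_INT) blast+
    qed
  qed (use K in auto)
  also have "\<dots> = (\<Prod>i\<in>fst ` K. \<Prod>j\<in>L i. prob (A (i, j)))"
  proof (intro prod.cong refl)
    fix i assume "i \<in> fst ` K"
    then show "prob (\<Inter>j\<in>L i. A (i, j)) = (\<Prod>j\<in>L i. prob (A (i, j)))"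
      using IK L AG by (intro indep_setsD[OF G(1) _ L_ne]) auto
  qed
  also have "\<dots> = (\<Prod>p\<in>K. prob (A p))"
    using K L by (subst (2) K_eq) (simp add: prod.Sigma)
  finally show "prob (\<Inter>p\<in>K. A p) = (\<Prod>p\<in>K. prob (A p))" .
qed

text \<open>Preimages under variables that agree almost surely have equal probability. Measurability
  of \<open>Y\<close> is a separate assumption because null sets need not be complete. The path
  properties of the processes hold only almost surely, so the increments are reached through this
  lemma.\<close>

lemma (in prob_space) indep_vars_AE_cong:
  assumes X: "indep_vars M' X I"
    and Y: "\<And>i. i \<in> I \<Longrightarrow> random_variable (M' i) (Y i)" "\<And>i. i \<in> I \<Longrightarrow> AE \<omega> in M. X i \<omega> = Y i \<omega>"
  shows "indep_vars M' Y I"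
  unfolding indep_vars_def2
proof (intro conjI ballI indep_setsI)
  fix A J
  assume J: "J \<noteq> {}" "J \<subseteq> I" "finite J" and "\<forall>j\<in>J. A j \<in> {Y j -` B \<inter> space M |B. B \<in> sets (M' j)}"
  then obtain B where B: "\<And>j. j \<in> J \<Longrightarrow> B j \<in> sets (M' j)" "\<And>j. j \<in> J \<Longrightarrow> A j = Y j -` B j \<inter> space M"
    by simp metis
  have X_rv: "random_variable (M' i) (X i)" if "i \<in> I" for i
    using X that by (simp add: indep_vars_def2)
  have AE_J: "AE \<omega> in M. \<forall>j\<in>J. X j \<omega> = Y j \<omega>"
    using Y(2) J by (intro AE_finite_allI) auto
  have "prob (\<Inter>j\<in>J. A j) = prob (\<Inter>j\<in>J. X j -` B j \<inter> space M)"
    using AE_J J B Y(1) X_rv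
    by (intro measure_eq_AE sets.finite_INT) (auto intro!: measurable_sets)
  also have "\<dots> = (\<Prod>j\<in>J. prob (X j -` B j \<inter> space M))"
    using J B by (intro indep_varsD[OF X]) auto
  also have "\<dots> = (\<Prod>j\<in>J. prob (A j))"
    using AE_J J B Y(1) X_rv
    by (intro prod.cong refl measure_eq_AE) (auto intro!: measurable_sets)
  finally show "prob (\<Inter>j\<in>J. A j) = (\<Prod>j\<in>J. prob (A j))" .
qed (use Y(1) in \<open>auto intro!: measurable_sets\<close>)

lemma (in prob_space) indep_vars_block_sums:
  fixes X :: "'i \<Rightarrow> 'a \<Rightarrow> real"
  assumes X: "indep_vars (\<lambda>_. borel) X I"
    and K: "\<And>l. l \<in> L \<Longrightarrow> K l \<subseteq> I" "disjoint_family_on K L"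
  shows "indep_vars (\<lambda>_. borel) (\<lambda>l \<omega>. \<Sum>i\<in>K l. X i \<omega>) L"
proof -
  \<comment> \<open>Each block sum is written as a measurable function of the restricted tuple,
    since the restrictions to disjoint blocks are independent.\<close>
  have "indep_vars (\<lambda>_. borel) (\<lambda>l \<omega>. (\<lambda>v. \<Sum>i\<in>K l. v i) (restrict (\<lambda>i. X i \<omega>) (K l))) L"
    by (rule indep_vars_compose2[OF indep_vars_restrict[OF X K]]) (auto intro!: borel_measurable_sum)
  then show ?thesis
    by (simp cong: indep_vars_cong)
qed

text \<open>Both characteristic functions are products over the summands, and \<open>h\<close>
  matches the factors; Levy's uniqueness theorem concludes.\<close>

lemma (in prob_space) distr_sum_eqI:
  fixes X :: "'i \<Rightarrow> 'a \<Rightarrow> real"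
  assumes X: "indep_vars (\<lambda>_. borel) X A" "indep_vars (\<lambda>_. borel) X B"
    and h: "bij_betw h A B" "\<And>i. i \<in> A \<Longrightarrow> distr M borel (X i) = distr M borel (X (h i))"
  shows "distr M borel (\<lambda>\<omega>. \<Sum>i\<in>A. X i \<omega>) = distr M borel (\<lambda>\<omega>. \<Sum>i\<in>B. X i \<omega>)"
proof (rule Levy_uniqueness)
  have "random_variable borel (\<lambda>\<omega>. \<Sum>i\<in>A. X i \<omega>)" "random_variable borel (\<lambda>\<omega>. \<Sum>i\<in>B. X i \<omega>)"
    using X by (auto simp: indep_vars_def2 intro!: borel_measurable_sum)
  then show "real_distribution (distr M borel (\<lambda>\<omega>. \<Sum>i\<in>A. X i \<omega>))"
    "real_distribution (distr M borel (\<lambda>\<omega>. \<Sum>i\<in>B. X i \<omega>))"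
    by auto
  show "char (distr M borel (\<lambda>\<omega>. \<Sum>i\<in>A. X i \<omega>)) = char (distr M borel (\<lambda>\<omega>. \<Sum>i\<in>B. X i \<omega>))"
    by (rule ext) (simp add: char_distr_sum X h(2) prod.reindex_bij_betw[OF h(1), symmetric])
qed

text \<open>The family \<open>X\<close> is indexed by pairs so that both noise processes contribute one entry per period; a
  jump amplitude carries the dummy second index 0. The count \<open>C 0\<close> covers the time before the first
  period: its law is irrelevant, but it shifts the block of jumps that every later period uses.\<close>
lemma (in prob_space) compound_increments_iid:
  fixes \<xi> Y :: "nat \<Rightarrow> 'a \<Rightarrow> real" and C :: "nat \<Rightarrow> 'a \<Rightarrow> nat"
  defines "X \<equiv> \<lambda>(i, k). case i of Diffusion \<Rightarrow> \<xi> k | Counting \<Rightarrow> (\<lambda>\<omega>. real (C k \<omega>)) | Jump j \<Rightarrow> Y j"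
    and "V \<equiv> \<lambda>k \<omega>. \<xi> k \<omega> + (\<Sum>j\<in>{(\<Sum>i<k. C i \<omega>)<..(\<Sum>i<Suc k. C i \<omega>)}. Y j \<omega>)"
  assumes n: "1 \<le> n"
    and X: "indep_vars (\<lambda>_. borel) X
      (Sigma ({Diffusion, Counting} \<union> Jump ` {1..}) (case_noise {1..n} {..n} (\<lambda>_. {0})))"
    and distr_\<xi>: "\<And>k. k \<in> {1..n} \<Longrightarrow> distr M borel (\<xi> k) = distr M borel (\<xi> 1)"
    and distr_C: "\<And>k. k \<in> {1..n} \<Longrightarrow> distr M (count_space UNIV) (C k) = distr M (count_space UNIV) (C 1)"
    and distr_Y: "\<And>j. 1 \<le> j \<Longrightarrow> distr M borel (Y j) = distr M borel (Y 1)"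
  shows "indep_vars (\<lambda>_. borel) V {1..n}"
    and "\<And>k. k \<in> {1..n} \<Longrightarrow> distr M borel (V k) = distr M borel (V 1)"
proof -
  define I where "I = Sigma ({Diffusion, Counting} \<union> Jump ` {1..}) (case_noise {1..n} {..n} (\<lambda>_. {0::nat}))"
  note X = X[folded I_def]
  have I_iff: "(Diffusion, k) \<in> I \<longleftrightarrow> k \<in> {1..n}" "(Counting, k) \<in> I \<longleftrightarrow> k \<le> n"
    "(Jump j, k) \<in> I \<longleftrightarrow> 1 \<le> j \<and> k = 0" for j k
    by (auto simp: I_def)
  have X_rv: "random_variable borel (X i)" if "i \<in> I" for i
    using X that by (simp add: indep_vars_def2)
  have \<xi>_rv [measurable]: "random_variable borel (\<xi> k)" if "k \<in> {1..n}" for k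
    using X_rv[of "(Diffusion, k)"] that by (simp add: X_def I_iff)
  have Y_rv: "random_variable borel (Y j)" if "1 \<le> j" for j
    using X_rv[of "(Jump j, 0)"] that by (simp add: X_def I_iff)
  have C_rv [measurable]: "C k \<in> measurable M (count_space UNIV)" if "k \<le> n" for k
  proof -
    have [measurable]: "random_variable borel (\<lambda>\<omega>. real (C k \<omega>))"
      using X_rv[of "(Counting, k)"] that by (simp add: X_def I_iff)
    \<comment> \<open>The family \<open>X\<close> is real-valued throughout, so the natural-number
      count is recovered from its real embedding.\<close>
    have "(\<lambda>\<omega>. nat \<lfloor>real (C k \<omega>)\<rfloor>) \<in> measurable M (count_space UNIV)"
      by measurable
    then show ?thesis by simp
  qed
  have V_rv: "random_variable borel (V k)" if k: "k \<in> {1..n}" for k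
  proof -
    have S: "(\<lambda>\<omega>. \<Sum>i<l. C i \<omega>) \<in> measurable M (count_space UNIV)" if "l \<le> Suc n" for l
      by (measurable, use that in auto)
    have Y_sum: "random_variable borel (\<lambda>\<omega>. \<Sum>j\<in>{a<..b}. Y j \<omega>)" for a b
      by (intro borel_measurable_sum Y_rv) auto
    \<comment> \<open>Both ends of the block are random but countably valued; they are made random
      one after the other, starting from fixed \<open>a\<close> and \<open>b\<close>.\<close>
    have "random_variable borel (\<lambda>\<omega>. \<Sum>j\<in>{(\<Sum>i<k. C i \<omega>)<..b}. Y j \<omega>)" for b
      by (rule measurable_compose_countable[OF Y_sum S]) (use k in auto)
    then have "random_variable borel (\<lambda>\<omega>. \<Sum>j\<in>{(\<Sum>i<k. C i \<omega>)<..(\<Sum>i<Suc k. C i \<omega>)}. Y j \<omega>)"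
      by (rule measurable_compose_countable[OF _ S]) (use k in auto)
    then show ?thesis
      using \<xi>_rv[OF k] by (simp add: V_def)
  qed
  \<comment> \<open>\<open>blk m k\<close> collects the entries of \<open>X\<close> that make up
    increment \<open>k\<close> when the counts equal \<open>m\<close>, and \<open>D m k\<close> is
    their sum. \<open>q r\<close> is the reference law: the diffusion part of period 1 plus the
    first \<open>r\<close> jumps.\<close>
  define blk where "blk m k = insert (Diffusion, k) ((\<lambda>j. (Jump j, 0)) ` {sum m {..<k}<..sum m {..<Suc k}})"
    for m :: "nat \<Rightarrow> nat" and k
  define D where "D m k \<omega> = (\<Sum>i\<in>blk m k. X i \<omega>)" for m k \<omega>
  define q where "q r A = prob ((\<lambda>\<omega>. \<Sum>i\<in>insert (Diffusion, 1) ((\<lambda>j. (Jump j, 0)) ` {1..r}). X i \<omega>) -` A \<inter> space M)"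
    for r :: nat and A
  have q_nonneg: "0 \<le> q r A" for r A
    by (simp add: q_def)
  have blk_I: "blk m k \<subseteq> I" if "k \<in> {1..n}" for m k
    using that by (auto simp: blk_def I_iff)
  have D_eq: "D m k \<omega> = \<xi> k \<omega> + (\<Sum>j\<in>{sum m {..<k}<..sum m {..<Suc k}}. Y j \<omega>)" for m k \<omega>
    by (simp add: D_def blk_def, subst sum.insert) (auto simp: X_def sum.reindex inj_on_def)
  have D_rv: "random_variable borel (D m k)" if "k \<in> {1..n}" for m k
    using blk_I[OF that] X_rv unfolding D_def[abs_def] by (intro borel_measurable_sum) auto
  have D_law: "prob (D m k -` A \<inter> space M) = q (m k) A" if k: "k \<in> {1..n}" and A: "A \<in> sets borel" for m k A
  proof -
    let ?B = "insert (Diffusion, 1) ((\<lambda>j. (Jump j, 0)) ` {1..m k})"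
    \<comment> \<open>\<open>h\<close> carries block \<open>k\<close> to the reference block: the
      diffusion entry moves to period 1, and jump numbers are shifted down by the number of earlier
      jumps.\<close>
    define h where "h = (\<lambda>(i, l). case i of Diffusion \<Rightarrow> (Diffusion, 1) | Counting \<Rightarrow> (Counting, l)
      | Jump j \<Rightarrow> (Jump (j - sum m {..<k}), 0::nat))"
    have B_I: "?B \<subseteq> I" using n by (auto simp: I_iff)
    have jumps: "(\<lambda>j. j - sum m {..<k}) ` {sum m {..<k}<..sum m {..<Suc k}} = {1..m k}"
    proof (intro set_eqI iffI)
      fix j assume "j \<in> {1..m k}"
      then show "j \<in> (\<lambda>j. j - sum m {..<k}) ` {sum m {..<k}<..sum m {..<Suc k}}"
        by (intro image_eqI[of _ _ "j + sum m {..<k}"]) auto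
    qed auto
    have "h ` blk m k = ?B"
      unfolding blk_def jumps[symmetric] by (simp add: h_def image_image)
    moreover have "inj_on h (blk m k)"
      by (auto simp: inj_on_def h_def blk_def)
    ultimately have bij: "bij_betw h (blk m k) ?B"
      by (simp add: bij_betw_def)
    have h_law: "distr M borel (X i) = distr M borel (X (h i))" if i: "i \<in> blk m k" for i
    proof -
      consider "i = (Diffusion, k)" | j where "sum m {..<k} < j" "i = (Jump j, 0)"
        using i by (auto simp: blk_def)
      then show ?thesis
      proof cases
        case 1
        then show ?thesis using distr_\<xi>[OF k] by (simp add: X_def h_def)
      next
        case 2
        then have "distr M borel (Y j) = distr M borel (Y (j - sum m {..<k}))"
          using distr_Y[of j] distr_Y[of "j - sum m {..<k}"] by simp
        then show ?thesis using 2 by (simp add: X_def h_def)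
      qed
    qed
    have "distr M borel (D m k) = distr M borel (\<lambda>\<omega>. \<Sum>i\<in>?B. X i \<omega>)"
      unfolding D_def[abs_def]
      by (rule distr_sum_eqI[OF indep_vars_subset[OF X blk_I[OF k]] indep_vars_subset[OF X B_I] bij h_law])
    then have "measure (distr M borel (D m k)) A = measure (distr M borel (\<lambda>\<omega>. \<Sum>i\<in>?B. X i \<omega>)) A"
      by simp
    moreover have "random_variable borel (\<lambda>\<omega>. \<Sum>i\<in>?B. X i \<omega>)"
      using B_I X_rv by (intro borel_measurable_sum) auto
    ultimately show ?thesis
      using A D_rv[OF k, of m] by (simp add: measure_distr q_def)
  qed
  have fixed_counts: "prob ((\<Inter>k\<in>{..n}. C k -` {m k} \<inter> space M) \<inter> (\<Inter>k\<in>{1..n}. D m k -` A k \<inter> space M)) =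
      (\<Prod>k\<in>{..n}. prob (C k -` {m k} \<inter> space M)) * (\<Prod>k\<in>{1..n}. q (m k) (A k))"
    if A: "\<And>k. k \<in> {1..n} \<Longrightarrow> A k \<in> sets borel" for m A
  proof -
    \<comment> \<open>The disjoint sum of index sets treats the counts (left) and the blocks (right)
      as one family of disjoint blocks, so counts and fixed-block sums are jointly
      independent.\<close>
    let ?L = "{..n} <+> {1..n}" and ?K = "case_sum (\<lambda>k. {(Counting, k)}) (blk m)"
    let ?A = "case_sum (\<lambda>k. {real (m k)}) A"
    have mono: "sum m {..<Suc k} \<le> sum m {..<l}" if "k < l" for k l
      using that by (intro sum_mono2) auto
    have disj: "{sum m {..<k}<..sum m {..<Suc k}} \<inter> {sum m {..<l}<..sum m {..<Suc l}} = {}" if "k \<noteq> l" for k l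
    proof (cases "k < l")
      case True then show ?thesis using mono[of k l] by auto
    next
      case False then show ?thesis using mono[of l k] that by auto
    qed
    have "disjoint_family_on ?K ?L"
      using disj by (fastforce simp: disjoint_family_on_def blk_def)
    moreover have "?K l \<subseteq> I" if "l \<in> ?L" for l
      using that blk_I by (cases l) (auto simp: I_iff simp del: atLeastAtMost_iff)
    ultimately have ind: "indep_vars (\<lambda>_. borel) (\<lambda>l \<omega>. \<Sum>i\<in>?K l. X i \<omega>) ?L"
      by (intro indep_vars_block_sums[OF X])
    define P where "P l = (\<lambda>\<omega>. \<Sum>i\<in>?K l. X i \<omega>) -` ?A l \<inter> space M" for l
    have P: "P (Inl k) = C k -` {m k} \<inter> space M" "P (Inr k) = D m k -` A k \<inter> space M" for k
      by (auto simp: P_def X_def D_def)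
    have "prob (\<Inter>l\<in>?L. P l) = (\<Prod>l\<in>?L. prob (P l))"
      unfolding P_def using A by (intro indep_varsD_finite[OF ind]) auto
    moreover have "(\<Inter>l\<in>?L. P l) = (\<Inter>k\<in>{..n}. P (Inl k)) \<inter> (\<Inter>k\<in>{1..n}. P (Inr k))"
      by blast
    moreover have "(\<Prod>l\<in>?L. prob (P l)) = (\<Prod>k\<in>{..n}. prob (P (Inl k))) * (\<Prod>k\<in>{1..n}. prob (P (Inr k)))"
      by (simp add: prod.Plus)
    moreover have "(\<Prod>k\<in>{1..n}. prob (P (Inr k))) = (\<Prod>k\<in>{1..n}. q (m k) (A k))"
      unfolding P using A by (intro prod.cong refl D_law)
    ultimately show ?thesis
      by (simp only: P)
  qed
  \<comment> \<open>\<open>g\<close> is the mixture of the reference laws \<open>q r\<close> over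
    the number \<open>r\<close> of jumps in a period; it turns out to be the common law of all
    \<open>V k\<close>.\<close>
  define g where "g A = (\<integral>\<^sup>+r. ennreal (prob (C 1 -` {r} \<inter> space M) * q r A) \<partial>count_space UNIV)" for A
  have C_law: "prob (C k -` {r} \<inter> space M) = prob (C 1 -` {r} \<inter> space M)" if "k \<in> {1..n}" for k r
  proof -
    have "measure (distr M (count_space UNIV) (C k)) {r} = measure (distr M (count_space UNIV) (C 1)) {r}"
      by (simp add: distr_C[OF that])
    then show ?thesis
      using that n by (simp add: measure_distr)
  qed
  have C_total: "(\<integral>\<^sup>+r. ennreal (prob (C k -` {r} \<inter> space M)) \<partial>count_space UNIV) = 1" if "k \<le> n" for k
  proof -
    have "(\<integral>\<^sup>+r. emeasure M (C k -` {r} \<inter> space M) \<partial>count_space UNIV) = emeasure M (\<Union>r. C k -` {r} \<inter> space M)"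
      using that by (intro emeasure_UN_countable[symmetric]) (auto simp: disjoint_family_on_def)
    also have "(\<Union>r. C k -` {r} \<inter> space M) = space M" by auto
    finally show ?thesis by (simp add: emeasure_eq_measure prob_space)
  qed
  have joint: "emeasure M (\<Inter>k\<in>{1..n}. V k -` A k \<inter> space M) = (\<Prod>k\<in>{1..n}. g (A k))"
    if A: "\<And>k. k \<in> {1..n} \<Longrightarrow> A k \<in> sets borel" for A
  proof -
    \<comment> \<open>\<open>f k\<close> is the weight contributed by period \<open>k\<close> to a
      count vector. Period 0 carries no event \<open>A\<close>, so its weights are bare
      probabilities and sum to 1.\<close>
    define f where "f k r = ennreal (if k = 0 then prob (C 0 -` {r} \<inter> space M)
      else prob (C 1 -` {r} \<inter> space M) * q r (A k))" for k r
    define E where "E m = (\<Inter>k\<in>{..n}. C k -` {m k} \<inter> space M) \<inter> (\<Inter>k\<in>{1..n}. D m k -` A k \<inter> space M)" for m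
    interpret P: product_sigma_finite "\<lambda>_::nat. count_space (UNIV :: nat set)"
      by (simp add: product_sigma_finite_def sigma_finite_measure_count_space)
    \<comment> \<open>On the event that the counts are \<open>m\<close>, the random blocks of jumps become the fixed blocks in \<open>D m\<close>.\<close>
    have E_V: "E m = (\<Inter>k\<in>{..n}. C k -` {m k} \<inter> space M) \<inter> (\<Inter>k\<in>{1..n}. V k -` A k \<inter> space M)" for m
    proof -
      have "V k \<omega> = D m k \<omega>" if "\<forall>k\<le>n. C k \<omega> = m k" "k \<in> {1..n}" for k \<omega>
      proof -
        have "(\<Sum>i<l. C i \<omega>) = sum m {..<l}" if "l \<le> Suc n" for l
          using \<open>\<forall>k\<le>n. C k \<omega> = m k\<close> that by (intro sum.cong) auto
        then show ?thesis
          using that by (simp add: V_def D_eq del: sum.lessThan_Suc)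
      qed
      then show ?thesis unfolding E_def by (intro set_eqI) auto
    qed
    have E_sets: "E m \<in> events" for m
    proof -
      have "(\<Inter>k\<in>{..n}. C k -` {m k} \<inter> space M) \<in> events"
        by (intro sets.finite_INT measurable_sets[OF C_rv]) auto
      moreover have "(\<Inter>k\<in>{1..n}. D m k -` A k \<inter> space M) \<in> events"
        using n A by (intro sets.finite_INT measurable_sets[OF D_rv]) auto
      ultimately show ?thesis unfolding E_def by (rule sets.Int)
    qed
    \<comment> \<open>Count vectors range over the extensional functions \<open>PiE\<close>: they
      are countably many, and distinct ones differ at some \<open>k \<le> n\<close>, which makes the
      events \<open>E m\<close> disjoint.\<close>
    have "(\<Inter>k\<in>{1..n}. V k -` A k \<inter> space M) = (\<Union>m\<in>PiE {..n} (\<lambda>_. UNIV). E m)"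
    proof (intro set_eqI iffI)
      fix \<omega> assume \<omega>: "\<omega> \<in> (\<Inter>k\<in>{1..n}. V k -` A k \<inter> space M)"
      then have "\<omega> \<in> space M" using n by auto
      then have "\<omega> \<in> E (\<lambda>k\<in>{..n}. C k \<omega>)"
        unfolding E_V using \<omega> by simp
      then show "\<omega> \<in> (\<Union>m\<in>PiE {..n} (\<lambda>_. UNIV). E m)"
        by (intro UN_I[of "\<lambda>k\<in>{..n}. C k \<omega>"]) auto
    next
      fix \<omega> assume "\<omega> \<in> (\<Union>m\<in>PiE {..n} (\<lambda>_. UNIV). E m)"
      then show "\<omega> \<in> (\<Inter>k\<in>{1..n}. V k -` A k \<inter> space M)"
        unfolding E_V by (elim UN_E IntD2)
    qed
    also have "emeasure M \<dots> = (\<integral>\<^sup>+m. emeasure M (E m) \<partial>count_space (PiE {..n} (\<lambda>_. UNIV)))"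
    proof (rule emeasure_UN_countable)
      show "disjoint_family_on E (PiE {..n} (\<lambda>_. UNIV))"
        unfolding disjoint_family_on_def
      proof (intro ballI impI equals0I)
        fix m m' \<omega> assume *: "m \<in> PiE {..n} (\<lambda>_. UNIV)" "m' \<in> PiE {..n} (\<lambda>_. UNIV)" "m \<noteq> m'" "\<omega> \<in> E m \<inter> E m'"
        then have "m k = m' k" if "k \<in> {..n}" for k
          using that by (auto simp: E_def)
        then have "m = m'" using * by (intro PiE_ext) auto
        with * show False by simp
      qed
    qed (auto intro!: countable_PiE E_sets)
    also have "\<dots> = (\<integral>\<^sup>+m. (\<Prod>k\<in>{..n}. f k (m k)) \<partial>count_space (PiE {..n} (\<lambda>_. UNIV)))"
    proof (intro nn_integral_cong)
      fix m
      have split: "{..n} = insert 0 {1..n}" using n by auto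
      have "prob (E m) = (\<Prod>k\<in>{..n}. prob (C k -` {m k} \<inter> space M)) * (\<Prod>k\<in>{1..n}. q (m k) (A k))"
        unfolding E_def by (rule fixed_counts[OF A])
      also have "\<dots> = prob (C 0 -` {m 0} \<inter> space M) *
          (\<Prod>k\<in>{1..n}. prob (C 1 -` {m k} \<inter> space M) * q (m k) (A k))"
      proof -
        have "(\<Prod>k\<in>{1..n}. prob (C k -` {m k} \<inter> space M)) = (\<Prod>k\<in>{1..n}. prob (C 1 -` {m k} \<inter> space M))"
          by (intro prod.cong refl C_law)
        then show ?thesis
          unfolding split by (simp add: prod.distrib)
      qed
      finally show "emeasure M (E m) = (\<Prod>k\<in>{..n}. f k (m k))"
        unfolding emeasure_eq_measure split by (simp add: f_def prod_ennreal q_nonneg ennreal_mult prod_nonneg)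
    qed
    \<comment> \<open>Counting measure on the vectors is the product of the counting measures, so
      the sum of products becomes a product of sums.\<close>
    also have "\<dots> = (\<integral>\<^sup>+m. (\<Prod>k\<in>{..n}. f k (m k)) \<partial>PiM {..n} (\<lambda>_. count_space UNIV))"
      by (subst count_space_PiM_finite) auto
    also have "\<dots> = (\<Prod>k\<in>{..n}. \<integral>\<^sup>+r. f k r \<partial>count_space UNIV)"
      by (rule P.product_nn_integral_prod) auto
    also have "\<dots> = (\<integral>\<^sup>+r. f 0 r \<partial>count_space UNIV) * (\<Prod>k\<in>{1..n}. \<integral>\<^sup>+r. f k r \<partial>count_space UNIV)"
    proof -
      have "{..n} = insert 0 {1..n}" using n by auto
      then show ?thesis by simp
    qed
    also have "\<dots> = (\<Prod>k\<in>{1..n}. g (A k))"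
      using C_total[of 0] by (simp add: f_def g_def)
    finally show ?thesis .
  qed
  have g_UNIV: "g UNIV = 1"
    using C_total[OF n] by (simp add: g_def q_def prob_space)
  have V_law: "emeasure M (V k -` A \<inter> space M) = g A" if k: "k \<in> {1..n}" and A: "A \<in> sets borel" for k A
  proof -
    \<comment> \<open>The marginal law comes from the joint one by putting \<open>UNIV\<close> in
      all other slots, each of which contributes \<open>g UNIV = 1\<close>.\<close>
    have "(\<Inter>l\<in>{1..n}. V l -` (if l = k then A else UNIV) \<inter> space M) = V k -` A \<inter> space M"
      using k by (auto split: if_splits)
    then have "emeasure M (V k -` A \<inter> space M) = (\<Prod>l\<in>{1..n}. g (if l = k then A else UNIV))"
      using joint[of "\<lambda>l. if l = k then A else UNIV"] A by simp
    also have "\<dots> = (\<Prod>l\<in>{1..n}. if l = k then g A else 1)"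
      using g_UNIV by (intro prod.cong) auto
    also have "\<dots> = g A"
      using k by (simp add: prod.delta)
    finally show ?thesis .
  qed
  show "indep_vars (\<lambda>_. borel) V {1..n}"
  \<comment> \<open>With the whole Borel sigma-algebra as generator, the product formula over the
    full index set suffices, since \<open>UNIV\<close> may fill any slot.\<close>
  proof (subst indep_vars_finite[where E = "\<lambda>_. sets borel"])
    show "\<forall>A\<in>{1..n} \<rightarrow> sets borel.
        prob (\<Inter>j\<in>{1..n}. V j -` A j \<inter> space M) = (\<Prod>j\<in>{1..n}. prob (V j -` A j \<inter> space M))"
    proof
      fix A :: "nat \<Rightarrow> real set" assume A: "A \<in> {1..n} \<rightarrow> sets borel"
      then have "ennreal (prob (\<Inter>j\<in>{1..n}. V j -` A j \<inter> space M)) =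
          ennreal (\<Prod>j\<in>{1..n}. prob (V j -` A j \<inter> space M))"
        using joint[of A] V_law
        by (simp add: emeasure_eq_measure[symmetric] prod_ennreal[symmetric] Pi_iff)
      then show "prob (\<Inter>j\<in>{1..n}. V j -` A j \<inter> space M) = (\<Prod>j\<in>{1..n}. prob (V j -` A j \<inter> space M))"
        by (simp add: prod_nonneg)
    qed
  qed (use n V_rv in \<open>auto simp: Int_stable_def sets.sigma_sets_eq[of borel, simplified]\<close>)
  show "distr M borel (V k) = distr M borel (V 1)" if "k \<in> {1..n}" for k
    using that n V_rv V_law by (intro measure_eqI) (auto simp: emeasure_distr)
qed

section \<open>Increments of the jump diffusion\<close>

text \<open>Presenting the family as the sets of a measure makes the measurability rules available
  for showing that an event belongs to a noise source.\<close>

lemma generated_events_eq_sets: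
  "generated_events Q M' I X = sets (sigma (space Q) {X i -` A \<inter> space Q |i A. i \<in> I \<and> A \<in> sets M'})"
  unfolding generated_events_def by (subst sets_measure_of) auto

lemma sigma_algebra_generated_events: "sigma_algebra (space Q) (generated_events Q M' I X)"
  unfolding generated_events_def by (rule sigma_algebra_sigma_sets) auto

lemma measurable_generated_events:
  assumes "i \<in> I" "X i \<in> measurable Q M'"
  shows "X i \<in> measurable (sigma (space Q) {X i -` A \<inter> space Q |i A. i \<in> I \<and> A \<in> sets M'}) M'"
proof (rule measurableI)
  fix A assume "A \<in> sets M'"
  then have "X i -` A \<inter> space Q \<in> generated_events Q M' I X"
    using assms(1) unfolding generated_events_def by (intro sigma_sets.Basic) auto
  then show "X i -` A \<inter> space (sigma (space Q) {X i -` A \<inter> space Q |i A. i \<in> I \<and> A \<in> sets M'})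
      \<in> sets (sigma (space Q) {X i -` A \<inter> space Q |i A. i \<in> I \<and> A \<in> sets M'})"
    by (simp add: generated_events_eq_sets space_measure_of_conv)
qed (use measurable_space[OF assms(2)] in \<open>simp add: space_measure_of_conv\<close>)

lemma vimage_in_generated_events:
  assumes "f \<in> measurable (sigma (space Q) {X i -` A \<inter> space Q |i A. i \<in> I \<and> A \<in> sets M'}) N"
    and "B \<in> sets N"
  shows "f -` B \<inter> space Q \<in> generated_events Q M' I X"
  using measurable_sets[OF assms] by (simp add: generated_events_eq_sets space_measure_of_conv)

lemma jump_diffusion_measurable:
  assumes "W s \<in> borel_measurable Q" "N s \<in> measurable Q (count_space UNIV)"
    and "\<And>j. 1 \<le> j \<Longrightarrow> Y j \<in> borel_measurable Q"
  shows "jump_diffusion \<gamma> \<sigma> W N Y s \<in> borel_measurable Q"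
proof -
  have "(\<lambda>\<omega>. \<Sum>j = 1..m. Y j \<omega>) \<in> borel_measurable Q" for m :: nat
    using assms(3) by (intro borel_measurable_sum) auto
  then have "(\<lambda>\<omega>. \<Sum>j = 1..N s \<omega>. Y j \<omega>) \<in> borel_measurable Q"
    by (rule measurable_compose_countable) (rule assms(2))
  with assms(1) show ?thesis
    unfolding jump_diffusion_def[abs_def] by measurable
qed

text \<open>Almost surely each increment is a diffusion part plus the jumps whose numbers lie
  between two values of \<open>N\<close>, which is the shape treated by
  \<open>compound_increments_iid\<close>. Independence of the ingredients combines the noise sources
  with the independent increments of \<open>W\<close> and \<open>N\<close>.\<close>

lemma jump_diffusion_increments_iid:
  fixes t :: "nat \<Rightarrow> real" and \<gamma> \<sigma> \<tau> :: real
  assumes prob: "prob_space Q"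
    and brownian: "standard_brownian_motion Q T W"
    and poisson: "poisson_process Q lam T N"
    and Y_rv: "\<And>j. 1 \<le> j \<Longrightarrow> Y j \<in> borel_measurable Q"
    and Y_law: "\<And>j. 1 \<le> j \<Longrightarrow> distr Q borel (Y j) = distr Q borel (Y 1)"
    and noise: "independent_noise Q T W N Y"
    and n: "1 \<le> n"
    and times: "0 \<le> t 0" "\<And>k. k \<in> {1..n} \<Longrightarrow> t (k - 1) < t k" "t n \<le> T"
    and equidistant: "\<And>k. k \<in> {1..n} \<Longrightarrow> t k - t (k - 1) = \<tau>"
  defines "X \<equiv> jump_diffusion \<gamma> \<sigma> W N Y"
  shows "prob_space.indep_vars Q (\<lambda>_. borel) (\<lambda>k \<omega>. X (t k) \<omega> - X (t (k - 1)) \<omega>) {1..n}"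
    and "\<And>k. k \<in> {1..n} \<Longrightarrow> distr Q borel (\<lambda>\<omega>. X (t k) \<omega> - X (t (k - 1)) \<omega>) =
           distr Q borel (\<lambda>\<omega>. X (t 1) \<omega> - X (t 0) \<omega>)"
proof -
  interpret prob_space Q by (rule prob)
  have t_mono: "t i \<le> t j" if "i \<le> j" "j \<le> n" for i j
    using that
  proof (induction j rule: dec_induct)
    case (step j)
    then show ?case using times(2)[of "Suc j"] by simp
  qed simp
  have t_range: "t i \<in> {0..T}" if "i \<le> n" for i
    using t_mono[of 0 i] t_mono[of i n] times that by simp
  \<comment> \<open>The grid \<open>t\<close> with time 0 put in front: for
    \<open>k \<ge> 1\<close>, period \<open>k\<close> runs from \<open>s k = t (k - 1)\<close> to
    \<open>s (Suc k) = t k\<close>, while period 0 runs from 0 to \<open>t 0\<close>.\<close>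
  define s where "s i = (case i of 0 \<Rightarrow> 0 | Suc j \<Rightarrow> t j)" for i
  have s_simps: "s 0 = 0" "s (Suc i) = t i" for i by (simp_all add: s_def)
  have s_pos: "s k = t (k - 1)" if "1 \<le> k" for k
    using that by (cases k) (simp_all add: s_def)
  have s_mono: "mono_on {..Suc n} s"
    using t_mono t_range by (auto simp: mono_on_def s_def split: nat.split)
  have s_range: "s i \<in> {0..T}" if "i \<le> Suc n" for i
    using t_range[of "i - 1"] t_range[of 0] that by (cases i) (auto simp: s_def)
  have s_le: "s i \<le> s j" if "i \<le> j" "j \<le> Suc n" for i j
    using s_mono that by (auto simp: mono_on_def)

  have W_rv: "W u \<in> borel_measurable Q" if "u \<in> {0..T}" for u
    using brownian that by (simp add: standard_brownian_motion_def)
  have N_rv: "N u \<in> measurable Q (count_space UNIV)" if "u \<in> {0..T}" for u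
    using poisson that by (simp add: poisson_process_def)
  \<comment> \<open>The subtraction is truncated; it is the true increment on the nondecreasing
    paths, to which \<open>D_V\<close> below restricts.\<close>
  define C where "C k \<omega> = N (s (Suc k)) \<omega> - N (s k) \<omega>" for k \<omega>
  \<comment> \<open>The drift is put into the diffusion part. The length \<open>\<tau>\<close> is
    that of periods 1 to \<open>n\<close>, and \<open>\<xi>\<close> enters the independent family
    for these only.\<close>
  define \<xi> where "\<xi> k \<omega> = \<gamma> * \<tau> + \<sigma> * (W (s (Suc k)) \<omega> - W (s k) \<omega>)" for k \<omega>
  define FW where "FW = sigma (space Q) {W u -` A \<inter> space Q |u A. u \<in> {0..T} \<and> A \<in> sets borel}"
  define FN where "FN = sigma (space Q) {N u -` A \<inter> space Q |u A. u \<in> {0..T} \<and> A \<in> sets (count_space UNIV)}"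
  have W_FW: "W u \<in> borel_measurable FW" if "u \<in> {0..T}" for u
    unfolding FW_def using that W_rv by (intro measurable_generated_events) auto
  have N_FN: "N u \<in> measurable FN (count_space UNIV)" if "u \<in> {0..T}" for u
    unfolding FN_def using that N_rv by (intro measurable_generated_events) auto
  have \<xi>_FW: "\<xi> k \<in> borel_measurable FW" if "k \<le> n" for k
    unfolding \<xi>_def[abs_def] using that
    by (intro borel_measurable_add borel_measurable_times borel_measurable_diff borel_measurable_const W_FW s_range) auto
  have C_FN: "C k \<in> measurable FN (count_space UNIV)" if "k \<le> n" for k
  proof -
    have [measurable]: "N (s (Suc k)) \<in> measurable FN (count_space UNIV)" "N (s k) \<in> measurable FN (count_space UNIV)"
      using that by (auto intro!: N_FN s_range)
    show ?thesis unfolding C_def[abs_def] by measurable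
  qed
  have W_indep: "indep_vars (\<lambda>_. borel) (\<lambda>i \<omega>. W (s (Suc i)) \<omega> - W (s i) \<omega>) {..<Suc n}"
    using brownian s_mono s_range[of 0] s_range[of "Suc n"]
    by (simp add: standard_brownian_motion_def independent_increments_def)
  have "indep_vars (\<lambda>_. borel) (\<lambda>i \<omega>. \<gamma> * \<tau> + \<sigma> * (W (s (Suc i)) \<omega> - W (s i) \<omega>)) {..<Suc n}"
    by (rule indep_vars_compose2[OF W_indep]) simp
  then have \<xi>_indep: "indep_vars (\<lambda>_. borel) \<xi> {1..n}"
    unfolding \<xi>_def[abs_def] by (rule indep_vars_subset) auto
  have "indep_vars (\<lambda>_. count_space UNIV) C {..<Suc n}"
    using poisson s_mono s_range[of 0] s_range[of "Suc n"]
    by (simp add: poisson_process_def independent_increments_def C_def[abs_def])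
  then have C_indep: "indep_vars (\<lambda>_. borel) (\<lambda>k \<omega>. real (C k \<omega>)) {..n}"
    using lessThan_Suc_atMost by (intro indep_vars_compose2[where Y = "\<lambda>_. real"]) auto

  let ?X = "\<lambda>(i, k). case i of Diffusion \<Rightarrow> \<xi> k | Counting \<Rightarrow> (\<lambda>\<omega>. real (C k \<omega>)) | Jump j \<Rightarrow> Y j"
  let ?I = "{Diffusion, Counting} \<union> Jump ` {1..}" and ?J = "case_noise {1..n} {..n} (\<lambda>_. {0::nat})"
  let ?F = "case_noise (generated_events Q borel {0..T} W) (generated_events Q (count_space UNIV) {0..T} N)
      (\<lambda>j. generated_events Q borel {j} Y)"
  let ?G = "\<lambda>i k. {?X (i, k) -` A \<inter> space Q | A. A \<in> sets (borel :: real measure)}"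
  have X_rv: "?X (i, k) \<in> borel_measurable Q" if "i \<in> ?I" "k \<in> ?J i" for i k
    using that \<xi>_indep C_indep Y_rv by (auto simp: indep_vars_def2)
  have G_indep: "indep_sets (\<lambda>(i, k). ?G i k) (Sigma ?I ?J)"
  \<comment> \<open>The first index is the noise source and the second the period. Independence
    across sources is the hypothesis on the noise; within \<open>W\<close> and \<open>N\<close> it
    is that of increments, and a jump source has a single entry.\<close>
  proof (rule indep_sets_Sigma)
    show "indep_sets ?F ?I"
      using noise by (simp add: independent_noise_def)
    show "sigma_algebra (space Q) (?F i)" for i
      by (cases i) (auto intro: sigma_algebra_generated_events)
    show "indep_sets (?G i) (?J i)" if i: "i \<in> ?I" for i
    proof -
      have "indep_vars (\<lambda>_. borel) (\<lambda>k. ?X (i, k)) (?J i)"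
      proof (cases i)
        case (Jump j)
        then show ?thesis using X_rv[OF i, of 0] by (auto simp: indep_vars_def2 indep_sets_def
          subset_singleton_iff prob_space)
      qed (use \<xi>_indep C_indep in simp_all)
      then show ?thesis by (simp add: indep_vars_def2)
    qed
    show "?G i k \<subseteq> ?F i" if "i \<in> ?I" "k \<in> ?J i" for i k
    proof (cases i)
      case Diffusion
      then show ?thesis
        using that \<xi>_FW[of k] vimage_in_generated_events[of "\<xi> k" Q W "{0..T}" borel borel]
        by (auto simp: FW_def)
    next
      case Counting
      have "(\<lambda>\<omega>. real (C k \<omega>)) \<in> borel_measurable FN"
        using Counting that C_FN[of k] by (intro measurable_compose[OF C_FN]) auto
      then show ?thesis
        using Counting vimage_in_generated_events[of "\<lambda>\<omega>. real (C k \<omega>)" Q N "{0..T}" "count_space UNIV" borel]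
        by (auto simp: FN_def)
    next
      case (Jump j)
      then show ?thesis
        by (auto simp: generated_events_def intro!: sigma_sets.Basic)
    qed
  qed
  have indep: "indep_vars (\<lambda>_. borel) ?X (Sigma ?I ?J)"
    unfolding indep_vars_def2
  proof (intro conjI ballI)
    have "(\<lambda>p. {?X p -` A \<inter> space Q | A. A \<in> sets (borel :: real measure)}) = (\<lambda>(i, k). ?G i k)"
      by (intro ext) (simp only: split_paired_all case_prod_conv)
    then show "indep_sets (\<lambda>p. {?X p -` A \<inter> space Q | A. A \<in> sets borel}) (Sigma ?I ?J)"
      using G_indep by (simp only:)
  next
    fix p assume "p \<in> Sigma ?I ?J"
    then show "?X p \<in> borel_measurable Q"
      using X_rv by (elim SigmaE) (simp only: case_prod_conv)
  qed

  have \<xi>_law: "distr Q borel (\<xi> k) = distr Q borel (\<xi> 1)" if "k \<in> {1..n}" for k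
  proof -
    \<comment> \<open>The right-hand side, an affine image of the centred normal law with variance
      \<open>\<tau>\<close>, does not depend on \<open>k\<close>.\<close>
    have "distr Q borel (\<xi> k) = distr (density lborel (normal_density 0 (sqrt \<tau>))) borel (\<lambda>w. \<gamma> * \<tau> + \<sigma> * w)"
      if k: "k \<in> {1..n}" for k
    proof -
      have "distributed Q lborel (\<lambda>\<omega>. W (t k) \<omega> - W (t (k - 1)) \<omega>) (normal_density 0 (sqrt (t k - t (k - 1))))"
        using brownian k times(2)[OF k] t_range[of k] t_range[of "k - 1"]
        by (auto simp: standard_brownian_motion_def)
      then have "distributed Q lborel (\<lambda>\<omega>. W (s (Suc k)) \<omega> - W (s k) \<omega>) (normal_density 0 (sqrt \<tau>))"
        using k s_pos equidistant[OF k] by (simp add: s_simps)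
      note d = distributed_distr_eq_density[OF this] distributed_measurable[OF this]
      show ?thesis
        unfolding d(1)[symmetric] \<xi>_def[abs_def]
        using d(2) by (subst distr_distr) (auto simp: comp_def)
    qed
    then show ?thesis using that n by simp
  qed
  have C_law: "distr Q (count_space UNIV) (C k) = distr Q (count_space UNIV) (C 1)" if "k \<in> {1..n}" for k
  proof -
    have "distr Q (count_space UNIV) (C k) = measure_pmf (poisson_pmf (lam * \<tau>))" if k: "k \<in> {1..n}" for k
    proof -
      have "distr Q (count_space UNIV) (\<lambda>\<omega>. N (t k) \<omega> - N (t (k - 1)) \<omega>) =
          measure_pmf (poisson_pmf (lam * (t k - t (k - 1))))"
        using poisson k times(2)[OF k] t_range[of k] t_range[of "k - 1"]
        by (auto simp: poisson_process_def)
      then show ?thesis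
        using k unfolding equidistant[OF k] by (simp add: C_def[abs_def] s_simps s_pos)
    qed
    then show ?thesis using that n by simp
  qed

  define V where "V k \<omega> = \<xi> k \<omega> + (\<Sum>j\<in>{(\<Sum>i<k. C i \<omega>)<..(\<Sum>i<Suc k. C i \<omega>)}. Y j \<omega>)" for k \<omega>
  have V: "indep_vars (\<lambda>_. borel) V {1..n}" "\<And>k. k \<in> {1..n} \<Longrightarrow> distr Q borel (V k) = distr Q borel (V 1)"
    unfolding V_def[abs_def] using compound_increments_iid[OF n indep \<xi>_law C_law Y_law] by blast+
  let ?D = "\<lambda>k \<omega>. X (t k) \<omega> - X (t (k - 1)) \<omega>"
  have D_rv: "?D k \<in> borel_measurable Q" if "k \<in> {1..n}" for k
    unfolding X_def using that t_range[of k] t_range[of "k - 1"]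
    by (intro borel_measurable_diff jump_diffusion_measurable W_rv N_rv Y_rv) auto
  have D_V: "AE \<omega> in Q. V k \<omega> = ?D k \<omega>" if k: "k \<in> {1..n}" for k
  proof -
    have "AE \<omega> in Q. N 0 \<omega> = 0" "AE \<omega> in Q. mono_on {0..T} (\<lambda>u. N u \<omega>)"
      using poisson by (simp_all add: poisson_process_def)
    then show ?thesis
    proof eventually_elim
      case (elim \<omega>)
      have N_mono: "N (s i) \<omega> \<le> N (s j) \<omega>" if "i \<le> j" "j \<le> Suc n" for i j
        using elim(2) s_range[of i] s_range[of j] s_le[OF that] that by (auto simp: mono_on_def)
      \<comment> \<open>The counts telescope: monotone paths make each truncated difference exact,
        and \<open>N 0 \<omega> = 0\<close> removes the initial value.\<close>
      have counts: "(\<Sum>i<l. C i \<omega>) = N (s l) \<omega>" if "l \<le> Suc n" for l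
        using that
      proof (induction l)
        case (Suc l)
        then show ?case using N_mono[of l "Suc l"] by (simp add: C_def)
      qed (simp add: s_simps elim(1))
      let ?a = "N (t (k - 1)) \<omega>" and ?b = "N (t k) \<omega>"
      have "?a \<le> ?b" using N_mono[of k "Suc k"] k by (simp add: s_simps s_pos)
      then have "{1..?b} = {1..?a} \<union> {?a<..?b}" by auto
      then have "(\<Sum>j = 1..?b. Y j \<omega>) = (\<Sum>j = 1..?a. Y j \<omega>) + (\<Sum>j\<in>{?a<..?b}. Y j \<omega>)"
        by (simp only:) (intro sum.union_disjoint, auto)
      moreover have "V k \<omega> = \<gamma> * \<tau> + \<sigma> * (W (t k) \<omega> - W (t (k - 1)) \<omega>) + (\<Sum>j\<in>{?a<..?b}. Y j \<omega>)"
        using k counts[of k] counts[of "Suc k"] by (simp add: V_def \<xi>_def s_simps s_pos del: sum.lessThan_Suc)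
      moreover have "\<gamma> * \<tau> = \<gamma> * t k - \<gamma> * t (k - 1)"
        by (simp only: equidistant[OF k, symmetric] right_diff_distrib)
      ultimately show ?case
        unfolding X_def jump_diffusion_def right_diff_distrib by linarith
    qed
  qed
  show "indep_vars (\<lambda>_. borel) ?D {1..n}"
    using D_rv D_V by (rule indep_vars_AE_cong[OF V(1)])
  have D_law: "distr Q borel (?D k) = distr Q borel (V k)" if "k \<in> {1..n}" for k
  proof (rule distr_cong_AE)
    show "AE \<omega> in Q. ?D k \<omega> = V k \<omega>"
      using D_V[OF that] by eventually_elim (rule sym)
    show "V k \<in> borel_measurable Q"
      using V(1) that by (simp add: indep_vars_def2)
  qed (use D_rv[OF that] in simp_all)
  show "distr Q borel (?D k) = distr Q borel (\<lambda>\<omega>. X (t 1) \<omega> - X (t 0) \<omega>)" if "k \<in> {1..n}" for k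
    using D_law[OF that] D_law[of 1] V(2)[OF that] n by simp
qed

section \<open>The price of the cliquet option\<close>

theorem proposition3p1:
  fixes Q :: "'a measure"
    and W :: "real \<Rightarrow> 'a \<Rightarrow> real" and N :: "real \<Rightarrow> 'a \<Rightarrow> nat" and Y :: "nat \<Rightarrow> 'a \<Rightarrow> real"
    and S\<^sub>0 \<sigma> lam \<eta> \<gamma> r T \<tau> c g K :: real
    and n :: nat and t :: "nat \<Rightarrow> real"
    and \<nu> :: "real measure"
    and X S :: "real \<Rightarrow> 'a \<Rightarrow> real" and R Z :: "nat \<Rightarrow> 'a \<Rightarrow> real" and H :: "'a \<Rightarrow> real"
    and phi_Z :: "real \<Rightarrow> complex"
  defines "\<nu> \<equiv> scale_measure (ennreal lam) (distr Q borel (Y 1))"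
    and "X \<equiv> jump_diffusion \<gamma> \<sigma> W N Y"
    and "S \<equiv> \<lambda>s \<omega>. S\<^sub>0 * exp (X s \<omega>)"
    and "R \<equiv> \<lambda>k \<omega>. (S (t k) \<omega> - S (t (k - 1)) \<omega>) / S (t (k - 1)) \<omega>"
    and "Z \<equiv> \<lambda>k \<omega>. min c (R k \<omega>) - g / real n"
    and "H \<equiv> \<lambda>\<omega>. K + K * max g (\<Sum>k = 1..n. min c (R k \<omega>))"
    and "phi_Z \<equiv> \<lambda>x. \<Prod>k = 1..n. char (distr Q borel (Z k)) x"
  assumes prob: "prob_space Q"
    and brownian: "standard_brownian_motion Q T W"
    and poisson: "poisson_process Q lam T N"
    and jumps_measurable: "\<And>j. 1 \<le> j \<Longrightarrow> Y j \<in> borel_measurable Q"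
    and jumps_identical: "\<And>j. 1 \<le> j \<Longrightarrow> distr Q borel (Y j) = distr Q borel (Y 1)"
    and indep: "independent_noise Q T W N Y"
    and pos: "S\<^sub>0 > 0" "\<sigma> > 0" "lam > 0" "r > 0"
    and gamma: "\<gamma> = \<eta> - \<sigma>\<^sup>2 / 2"
    and exp_moment: "integrable \<nu> (\<lambda>z. exp z - 1)"
    and risk_neutral: "\<eta> = r - (\<integral>z. (exp z - 1) \<partial>\<nu>)"
    and n: "1 \<le> n"
    and times: "0 < t 0" "\<And>k. k \<in> {1..n} \<Longrightarrow> t (k - 1) < t k" "t n \<le> T"
    and equidistant: "\<And>k. k \<in> {1..n} \<Longrightarrow> t k - t (k - 1) = \<tau>"
    and cap: "0 \<le> c"
  shows "prob_space.indep_vars Q (\<lambda>_. borel) Z {1..n}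
    \<and> (\<forall>k\<in>{1..n}. distr Q borel (Z k) = distr Q borel (Z 1))
    \<and> (\<forall>x. phi_Z x = (\<Prod>k = 1..n. (CLINT \<omega>|Q. exp (\<i> * of_real (x * Z k \<omega>))))
          \<and> phi_Z x = (char (distr Q borel (Z 1)) x) ^ n
          \<and> phi_Z x = (CLINT \<omega>|Q. exp (\<i> * of_real (x * Z 1 \<omega>))) ^ n)
    \<and> integrable Q H
    \<and> integrable Q (Z 1)
    \<and> set_integrable lborel {0<..} (\<lambda>x. (1 - Re (phi_Z x)) / x\<^sup>2)
    \<and> time_zero_price Q r T H =
        K * exp (- r * T) * (1 + g + real n / 2 * (\<integral>\<omega>. Z 1 \<omega> \<partial>Q)
          + 1 / pi * (LBINT x:{0<..}. (1 - Re (phi_Z x)) / x\<^sup>2))"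
proof -
  interpret prob_space Q by (rule prob)
  \<comment> \<open>\<open>D k\<close> is the log-return of period \<open>k\<close>;
    \<open>h\<close> turns it into \<open>Z k\<close>, so the i.i.d. property passes from
    \<open>D\<close> to \<open>Z\<close>.\<close>
  define D where "D k \<omega> = X (t k) \<omega> - X (t (k - 1)) \<omega>" for k \<omega>
  define h where "h x = min c (exp x - 1) - g / real n" for x
  have h_borel [measurable]: "h \<in> borel_measurable borel"
    unfolding h_def[abs_def] by measurable
  have D: "indep_vars (\<lambda>_. borel) D {1..n}" "\<And>k. k \<in> {1..n} \<Longrightarrow> distr Q borel (D k) = distr Q borel (D 1)"
    using jump_diffusion_increments_iid[OF prob brownian poisson jumps_measurable jumps_identical indep n
        less_imp_le[OF times(1)] times(2,3) equidistant]
    by (simp_all add: D_def[abs_def] X_def)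
  have "R k \<omega> = exp (D k \<omega>) - 1" for k \<omega>
    using pos(1) by (simp add: R_def S_def D_def exp_diff diff_divide_distrib)
  then have Z_eq: "Z k = (\<lambda>\<omega>. h (D k \<omega>))" for k
    by (simp add: Z_def h_def)
  have D_rv: "D k \<in> borel_measurable Q" if "k \<in> {1..n}" for k
    using D(1) that by (simp add: indep_vars_def2)
  have Z_rv: "Z k \<in> borel_measurable Q" if "k \<in> {1..n}" for k
    unfolding Z_eq using D_rv[OF that] by measurable
  have Z_indep: "indep_vars (\<lambda>_. borel) Z {1..n}"
    unfolding Z_eq[abs_def] by (rule indep_vars_compose2[OF D(1)]) measurable
  have Z_law: "distr Q borel (Z k) = distr Q borel (Z 1)" if "k \<in> {1..n}" for k
  proof -
    have "distr Q borel (Z k) = distr (distr Q borel (D k)) borel h" if "k \<in> {1..n}" for k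
      unfolding Z_eq using D_rv[OF that] by (subst distr_distr) (auto simp: comp_def)
    then show ?thesis using that n D(2)[OF that] by simp
  qed
  have Z_int: "integrable Q (Z k)" if "k \<in> {1..n}" for k
  proof (rule integrable_const_bound)
    \<comment> \<open>\<open>Z k\<close> is bounded: \<open>exp\<close> is positive, so the return
      is above -1, and the cap bounds it from above.\<close>
    show "AE \<omega> in Q. norm (Z k \<omega>) \<le> 1 + c + \<bar>g / real n\<bar>"
    proof (intro AE_I2)
      fix \<omega>
      have "- 1 \<le> min c (exp (D k \<omega>) - 1)" "min c (exp (D k \<omega>) - 1) \<le> c"
        using cap by (auto intro: order_trans[of _ 0])
      then show "norm (Z k \<omega>) \<le> 1 + c + \<bar>g / real n\<bar>"
        using cap unfolding Z_eq h_def real_norm_def by linarith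
    qed
  qed (rule Z_rv[OF that])
  have Z_mean: "expectation (Z k) = expectation (Z 1)" if "k \<in> {1..n}" for k
  proof -
    have "expectation (Z k) = (\<integral>x. x \<partial>distr Q borel (Z k))" if "k \<in> {1..n}" for k
      using Z_rv[OF that] by (simp add: integral_distr)
    then show ?thesis using that n Z_law[OF that] by simp
  qed
  have char_Z: "char (distr Q borel (Z k)) x = (CLINT \<omega>|Q. exp (\<i> * of_real (x * Z k \<omega>)))"
    if "k \<in> {1..n}" for k x
    using Z_rv[OF that] by (simp add: char_def integral_distr)
  have phi_prod: "phi_Z x = (\<Prod>k = 1..n. (CLINT \<omega>|Q. exp (\<i> * of_real (x * Z k \<omega>))))" for x
    unfolding phi_Z_def by (intro prod.cong refl char_Z)
  have phi_power: "phi_Z x = (char (distr Q borel (Z 1)) x) ^ n" for x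
  proof -
    have "phi_Z x = (\<Prod>k = 1..n. char (distr Q borel (Z 1)) x)"
      unfolding phi_Z_def by (intro prod.cong refl) (simp only: Z_law)
    then show ?thesis by simp
  qed

  define V where "V \<omega> = (\<Sum>k = 1..n. Z k \<omega>)" for \<omega>
  have V_int: "integrable Q V"
    unfolding V_def[abs_def] using Z_int by (intro Bochner_Integration.integrable_sum) auto
  have V_mean: "expectation V = real n * expectation (Z 1)"
  proof -
    have "expectation V = (\<Sum>k = 1..n. expectation (Z k))"
      unfolding V_def[abs_def] using Z_int by (intro Bochner_Integration.integral_sum) auto
    also have "\<dots> = (\<Sum>k = 1..n. expectation (Z 1))"
      by (intro sum.cong refl Z_mean)
    finally show ?thesis by simp
  qed
  have V_char: "char (distr Q borel V) x = phi_Z x" for x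
    unfolding V_def[abs_def] phi_Z_def by (rule char_distr_sum[OF Z_indep])
  have H_eq: "H = (\<lambda>\<omega>. K * (1 + g + (V \<omega> + \<bar>V \<omega>\<bar>) / 2))"
  proof
    fix \<omega>
    \<comment> \<open>The \<open>n\<close> subtracted shares \<open>g / real n\<close> add up to
      \<open>g\<close>, because \<open>n\<close> is nonzero.\<close>
    have "(\<Sum>k = 1..n. min c (R k \<omega>)) = V \<omega> + g"
      using n by (simp add: V_def Z_def sum_subtractf)
    moreover have "max g (V \<omega> + g) = g + (V \<omega> + \<bar>V \<omega>\<bar>) / 2"
      by (simp add: max_def abs_if)
    ultimately show "H \<omega> = K * (1 + g + (V \<omega> + \<bar>V \<omega>\<bar>) / 2)"
      by (simp add: H_def distrib_left)
  qed
  \<comment> \<open>Integrability belongs to the conclusion because a Bochner integral defaults to 0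
    otherwise; it makes the price a genuine expectation.\<close>
  have H_int: "integrable Q H"
    unfolding H_eq using V_int by simp
  have abs_V: "has_bochner_integral lborel (\<lambda>x. indicator {0<..} x * ((1 - Re (phi_Z x)) / x\<^sup>2))
      (pi / 2 * expectation (\<lambda>\<omega>. \<bar>V \<omega>\<bar>))"
    using has_bochner_integral_one_minus_char[OF V_int] by (simp only: V_char)
  then have set_int: "set_integrable lborel {0<..} (\<lambda>x. (1 - Re (phi_Z x)) / x\<^sup>2)"
    unfolding set_integrable_def real_scaleR_def by (rule integrable.intros)
  have set_val: "(LBINT x:{0<..}. (1 - Re (phi_Z x)) / x\<^sup>2) = pi / 2 * expectation (\<lambda>\<omega>. \<bar>V \<omega>\<bar>)"
    unfolding set_lebesgue_integral_def real_scaleR_def by (rule has_bochner_integral_integral_eq[OF abs_V])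
  have "expectation H = K * (1 + g + (expectation V + expectation (\<lambda>\<omega>. \<bar>V \<omega>\<bar>)) / 2)"
    unfolding H_eq using V_int by (simp add: prob_space)
  \<comment> \<open>The factor \<open>1 / pi\<close> cancels against \<open>pi / 2\<close> in
    \<open>set_val\<close> and leaves half of the mean of \<open>\<bar>V\<bar>\<close>; the other
    half-term is the mean of \<open>V\<close>.\<close>
  then have price: "time_zero_price Q r T H = K * exp (- r * T) * (1 + g + real n / 2 * expectation (Z 1)
      + 1 / pi * (LBINT x:{0<..}. (1 - Re (phi_Z x)) / x\<^sup>2))"
    unfolding time_zero_price_def set_val V_mean by (simp add: add_divide_distrib)
  have one: "1 \<in> {1..n}" using n by simp
  show ?thesis
    using phi_prod phi_power phi_power[unfolded char_Z[OF one]]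
    by (intro conjI ballI allI Z_indep Z_law H_int Z_int[OF one] set_int price)
qed

end
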